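(* Let $\boldsymbol{z}\in\mathbb{F}^n$ be an arbitrary interpolation node, let $\prec$ be a graded order, and let the Birkhoff interpolation conditions $$\Delta_{\boldsymbol{z}}=\delta_{\boldsymbol{z}}\circ\operatorname{span}\{P_1(D),P_2(D),\dots,P_N(D)\}$$ be given, where $P_1,\dots,P_N\in\mathbb{F}[\boldsymbol{x}]$. If $\{P_1(\boldsymbol{x}),P_2(\boldsymbol{x}),\dots,P_N(\boldsymbol{x})\}$ is a reverse reduced set with respect to $\prec$, then $$\{\operatorname{lm}(P_1(\boldsymbol{x})),\operatorname{lm}(P_2(\boldsymbol{x})),\dots,\operatorname{lm}(P_N(\boldsymbol{x}))\}$$ forms a minimal monomial basis for $\Delta_{\boldsymbol{z}}$ with respect to $\prec$.
   Context: $\mathbb{F}$ is $\mathbb{R}$ or $\mathbb{C}$ and $\mathbb{F}[\boldsymbol{x}]=\mathbb{F}[x_1,\dots,x_n]$. For $\boldsymbol{\alpha}\in\mathbb{N}^n$, $D^{\boldsymbol{\alpha}}=\partial^{|\boldsymbol{\alpha}|}/\partial x_1^{\alpha_1}\cdots\partial x_n^{\alpha_n}$; for $P=\sum_{\boldsymbol{\alpha}}e_{\boldsymbol{\alpha}}\boldsymbol{x}^{\boldsymbol{\alpha}}$, $P(D)=\sum_{\boldsymbol{\alpha}}e_{\boldsymbol{\alpha}}D^{\boldsymbol{\alpha}}$. $\delta_{\boldsymbol{z}}$ is evaluation at $\boldsymbol{z}$, and $\delta_{\boldsymbol{z}}\circ P(D)$ is the functional $f\mapsto (P(D)f)(\boldsymbol{z})$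 on $\mathbb{F}[\boldsymbol{x}]$; $\delta_{\boldsymbol{z}}\circ\operatorname{span}\{P_1(D),\dots,P_N(D)\}$ is the span of the functionals $\delta_{\boldsymbol{z}}\circ P_j(D)$. A graded order is a monomial order that compares total degree first. $\operatorname{lm}(P)$ is the least monomial with respect to $\prec$ among those occurring in $P$ with nonzero coefficient. The support $\Lambda\{P\}$ is the set of monomials occurring in $P$ with nonzero coefficient. A set of linearly independent polynomials $\{P_1,\dots,P_N\}$ is a reverse reduced set with respect to $\prec$ if (1) for each $i$ the coefficient of $\operatorname{lm}(P_i)$ in $P_i$ is $1$; (2) for all $i\neq j$, $\operatorname{lm}(P_i)\notin\Lambda\{P_j\}$. For linearly independent functionals $L_1,\dots,L_N$ on $\mathbb{F}[\boldsymbol{x}]$ and $\Delta=\operatorname{span}\{L_1,\dots,L_N\}$, a finite set $T$ of monomials is a proper interpolation basis for $\Delta$ if for all values $c_1,\dots,c_N\in\mathbb{F}$ there is a unique $p\in\operatorname{span}T$ with $L_i(p)=c_i$ for all $i$, where $|T|=N$. $T$ is a minimal monomial basis for $\Delta$ with respect to $\prec$ if (1) $T$ is a proper interpolation basis for $\Delta$; (2) replacing any monomial in $T$ by a monomial that is lower in the order $\prec$ can never yield another proper interpolation basis for $\Delta$. *)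

theory Defs
  imports
    "HOL-Analysis.Finite_Cartesian_Product"
    "HOL-Library.Poly_Mapping"
    "HOL-Library.Function_Algebras"
begin

text \<open>
  Monomials are exponent vectors indexed by a finite type \<open>'n\<close> (so \<open>n = CARD('n)\<close>), and
  polynomials are finitely supported maps from monomials to coefficients: \<open>lookup P m\<close> is the
  coefficient of \<open>m\<close> in \<open>P\<close>, and \<open>keys P\<close> is the support of \<open>P\<close>.
\<close>

abbreviation lookup :: "('b \<Rightarrow>\<^sub>0 'c::zero) \<Rightarrow> 'b \<Rightarrow> 'c" where
  "lookup \<equiv> Poly_Mapping.lookup"

abbreviation keys :: "('b \<Rightarrow>\<^sub>0 'c::zero) \<Rightarrow> 'b set" where
  "keys \<equiv> Poly_Mapping.keys"

type_synonym 'n monomial = "'n \<Rightarrow>\<^sub>0 nat"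
type_synonym ('n, 'a) mpoly = "'n monomial \<Rightarrow>\<^sub>0 'a"

definition total_degree :: "'n::finite monomial \<Rightarrow> nat" where
  "total_degree m = (\<Sum>i\<in>UNIV. lookup m i)"

subsection \<open>Linear structure\<close>

definition mpoly_scale :: "'a::field \<Rightarrow> ('n, 'a) mpoly \<Rightarrow> ('n, 'a) mpoly" where
  "mpoly_scale c P = Poly_Mapping.map ((*) c) P"

definition functional_scale :: "'a::field \<Rightarrow> ('b \<Rightarrow> 'a) \<Rightarrow> 'b \<Rightarrow> 'a" where
  "functional_scale c L = (\<lambda>f. c * L f)"

lemma lookup_mpoly_scale [simp]: "lookup (mpoly_scale c P) m = c * lookup P m"
  by (simp add: mpoly_scale_def map.rep_eq when_def)

global_interpretation mpoly: vector_space "mpoly_scale :: 'a::field \<Rightarrow> ('n, 'a) mpoly \<Rightarrow> _"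
  by unfold_locales (auto intro!: poly_mapping_eqI simp: lookup_add algebra_simps)

global_interpretation functional: vector_space "functional_scale :: 'a::field \<Rightarrow> ('b \<Rightarrow> 'a) \<Rightarrow> _"
  by unfold_locales (auto simp: functional_scale_def algebra_simps)

subsection \<open>Differential operators and evaluation\<close>

definition partial :: "'n \<Rightarrow> ('n, 'a::field) mpoly \<Rightarrow> ('n, 'a) mpoly" where
  "partial i f = (\<Sum>m\<in>keys f.
     Poly_Mapping.single (m - Poly_Mapping.single i 1) (of_nat (lookup m i) * lookup f m))"

text \<open>The iterated partial derivatives commute, so the order in which \<open>Finite_Set.fold\<close> applies
  them is irrelevant; see \<open>partial_funpow_commute\<close> and \<open>lookup_diff_monomial\<close> below.\<close>

definition diff_monomial :: "'n::finite monomial \<Rightarrow> ('n, 'a::field) mpoly \<Rightarrow> ('n, 'a) mpoly" where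
  "diff_monomial \<alpha> f = Finite_Set.fold (\<lambda>i. partial i ^^ lookup \<alpha> i) f UNIV"

definition diff_op :: "('n::finite, 'a::field) mpoly \<Rightarrow> ('n, 'a) mpoly \<Rightarrow> ('n, 'a) mpoly" where
  "diff_op P f = (\<Sum>\<alpha>\<in>keys P. mpoly_scale (lookup P \<alpha>) (diff_monomial \<alpha> f))"

definition mpoly_eval :: "'a ^ 'n \<Rightarrow> ('n::finite, 'a::field) mpoly \<Rightarrow> 'a" where
  "mpoly_eval z f = (\<Sum>m\<in>keys f. lookup f m * (\<Prod>i\<in>UNIV. (z $ i) ^ lookup m i))"

definition birkhoff_functional ::
    "'a ^ 'n \<Rightarrow> ('n::finite, 'a::field) mpoly \<Rightarrow> ('n, 'a) mpoly \<Rightarrow> 'a" where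
  "birkhoff_functional z P = (\<lambda>f. mpoly_eval z (diff_op P f))"

subsection \<open>Monomial orders and reverse reduced sets\<close>

definition monomial_order :: "('n monomial \<Rightarrow> 'n monomial \<Rightarrow> bool) \<Rightarrow> bool" where
  "monomial_order prec \<longleftrightarrow>
     irreflp prec \<and> transp prec \<and> totalp prec \<and> wfp prec \<and>
     (\<forall>a b c. prec a b \<longrightarrow> prec (a + c) (b + c))"

definition graded_order :: "('n::finite monomial \<Rightarrow> 'n monomial \<Rightarrow> bool) \<Rightarrow> bool" where
  "graded_order prec \<longleftrightarrow>
     monomial_order prec \<and> (\<forall>a b. total_degree a < total_degree b \<longrightarrow> prec a b)"

text \<open>Note that this is the \<^emph>\<open>least\<close> monomial of the support; it is unspecified for \<open>P = 0\<close>.\<close>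

definition lm :: "('n monomial \<Rightarrow> 'n monomial \<Rightarrow> bool) \<Rightarrow> ('n, 'a::zero) mpoly \<Rightarrow> 'n monomial" where
  "lm prec P = (THE m. m \<in> keys P \<and> (\<forall>m'\<in>keys P. m' \<noteq> m \<longrightarrow> prec m m'))"

definition reverse_reduced ::
    "('n monomial \<Rightarrow> 'n monomial \<Rightarrow> bool) \<Rightarrow> nat \<Rightarrow> (nat \<Rightarrow> ('n, 'a::field) mpoly) \<Rightarrow> bool" where
  "reverse_reduced prec N P \<longleftrightarrow>
     inj_on P {1..N} \<and> mpoly.independent (P ` {1..N}) \<and>
     (\<forall>i\<in>{1..N}. lookup (P i) (lm prec (P i)) = 1) \<and>
     (\<forall>i\<in>{1..N}. \<forall>j\<in>{1..N}. i \<noteq> j \<longrightarrow> lm prec (P i) \<notin> keys (P j))"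

subsection \<open>Interpolation bases\<close>

definition functional_basis ::
    "nat \<Rightarrow> (nat \<Rightarrow> ('n, 'a::field) mpoly \<Rightarrow> 'a) \<Rightarrow> (('n, 'a) mpoly \<Rightarrow> 'a) set \<Rightarrow> bool" where
  "functional_basis N L \<Delta> \<longleftrightarrow>
     (\<forall>i\<in>{1..N}. Vector_Spaces.linear mpoly_scale (*) (L i)) \<and>
     inj_on L {1..N} \<and> functional.independent (L ` {1..N}) \<and>
     \<Delta> = functional.span (L ` {1..N})"

definition monomial_span :: "'n monomial set \<Rightarrow> ('n, 'a::field) mpoly set" where
  "monomial_span T = mpoly.span ((\<lambda>m. Poly_Mapping.single m 1) ` T)"

definition unisolvent ::
    "nat \<Rightarrow> (nat \<Rightarrow> ('n, 'a::field) mpoly \<Rightarrow> 'a) \<Rightarrow> 'n monomial set \<Rightarrow> bool" where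
  "unisolvent N L T \<longleftrightarrow> (\<forall>c. \<exists>!p. p \<in> monomial_span T \<and> (\<forall>i\<in>{1..N}. L i p = c i))"

text \<open>The choice of the basis \<open>L\<close> of \<open>\<Delta>\<close> does not matter; see
  \<open>proper_interpolation_basis_iff\<close> below.\<close>

definition proper_interpolation_basis ::
    "(('n, 'a::field) mpoly \<Rightarrow> 'a) set \<Rightarrow> 'n monomial set \<Rightarrow> bool" where
  "proper_interpolation_basis \<Delta> T \<longleftrightarrow>
     finite T \<and> (\<exists>N L. functional_basis N L \<Delta> \<and> card T = N \<and> unisolvent N L T)"

definition minimal_monomial_basis ::
    "('n monomial \<Rightarrow> 'n monomial \<Rightarrow> bool) \<Rightarrow> (('n, 'a::field) mpoly \<Rightarrow> 'a) set \<Rightarrow>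
      'n monomial set \<Rightarrow> bool" where
  "minimal_monomial_basis prec \<Delta> T \<longleftrightarrow>
     proper_interpolation_basis \<Delta> T \<and>
     (\<forall>t\<in>T. \<forall>m. prec m t \<longrightarrow> \<not> proper_interpolation_basis \<Delta> (insert m (T - {t})))"

subsection \<open>Well-definedness of the notions above\<close>

lemma lookup_partial:
  "lookup (partial i f) k =
     of_nat (lookup k i + 1) * lookup f (k + Poly_Mapping.single i 1)"
proof -
  let ?e = "Poly_Mapping.single i (1::nat)"
  have pm: "of_nat (lookup m i) * lookup f m * (if m - ?e = k then 1 else 0) =
    (if m = k + ?e then of_nat (lookup k i + 1) * lookup f (k + ?e) else 0)" for m
  proof (cases "lookup m i = 0")
    case True
    then have "m \<noteq> k + ?e" by (auto simp: lookup_add)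
    with True show ?thesis by simp
  next
    case False
    have "m - ?e = k \<longleftrightarrow> m = k + ?e"
    proof
      assume h: "m - ?e = k"
      show "m = k + ?e"
        using False unfolding h[symmetric]
        by (intro poly_mapping_eqI) (auto simp: lookup_add lookup_minus lookup_single when_def)
    qed simp
    then show ?thesis by (auto simp: lookup_add)
  qed
  have "lookup (partial i f) k =
      (\<Sum>m\<in>keys f. of_nat (lookup m i) * lookup f m * (if m - ?e = k then 1 else 0))"
    by (auto simp: partial_def lookup_sum lookup_single when_def intro!: sum.cong)
  also have "\<dots> = (\<Sum>m\<in>keys f. if m = k + ?e then of_nat (lookup k i + 1) * lookup f (k + ?e) else 0)"
    by (simp only: pm)
  also have "\<dots> = of_nat (lookup k i + 1) * lookup f (k + ?e)"
    by (auto simp: in_keys_iff)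
  finally show ?thesis .
qed

lemma partial_commute: "partial i (partial j f) = partial j (partial i f)"
  by (rule poly_mapping_eqI)
     (auto simp: lookup_partial lookup_add lookup_single when_def ac_simps)

lemma partial_funpow_commute:
  "(partial i ^^ a) ((partial j ^^ b) f) = (partial j ^^ b) ((partial i ^^ a) f)"
proof -
  have 1: "partial i ((partial j ^^ b) f) = (partial j ^^ b) (partial i f)" for f
    by (induction b) (simp_all, metis partial_commute)
  show ?thesis by (induction a) (simp_all add: 1)
qed

lemma lookup_partial_funpow:
  "lookup ((partial i ^^ a) f) k =
     pochhammer (of_nat (lookup k i) + 1) a * lookup f (k + Poly_Mapping.single i a)"
proof (induction a arbitrary: k)
  case (Suc a)
  have "k + Poly_Mapping.single i 1 + Poly_Mapping.single i a = k + Poly_Mapping.single i (Suc a)"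
    by (simp add: add.assoc flip: single_add)
  then show ?case
    by (simp add: lookup_partial Suc.IH lookup_add pochhammer_rec ac_simps)
qed simp

lemma lookup_diff_monomial:
  fixes f :: "('n::finite, 'a::field) mpoly"
  shows "lookup (diff_monomial \<alpha> f) k =
    (\<Prod>i\<in>UNIV. pochhammer (of_nat (lookup k i) + 1) (lookup \<alpha> i)) * lookup f (k + \<alpha>)"
proof -
  let ?g = "\<lambda>i. partial i ^^ lookup \<alpha> i :: ('n, 'a) mpoly \<Rightarrow> _"
  interpret comp_fun_commute ?g
    by standard (auto simp: partial_funpow_commute)
  have "lookup (Finite_Set.fold ?g f S) k =
     (\<Prod>i\<in>S. pochhammer (of_nat (lookup k i) + 1) (lookup \<alpha> i)) *
       lookup f (k + (\<Sum>i\<in>S. Poly_Mapping.single i (lookup \<alpha> i)))"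
    if "finite S" for S k
    using that
  proof (induction S arbitrary: k rule: finite_induct)
    case (insert i S)
    have "(\<Prod>j\<in>S. pochhammer (of_nat (lookup (k + Poly_Mapping.single i (lookup \<alpha> i)) j) + 1) (lookup \<alpha> j))
       = (\<Prod>j\<in>S. pochhammer (of_nat (lookup k j) + 1 :: 'a) (lookup \<alpha> j))"
      using insert.hyps by (intro prod.cong) (auto simp: lookup_add lookup_single when_def)
    with insert show ?case
      by (simp add: lookup_partial_funpow ac_simps)
  qed simp
  moreover have "(\<Sum>i\<in>UNIV. Poly_Mapping.single i (lookup \<alpha> i)) = \<alpha>"
    by (rule poly_mapping_eqI) (simp add: lookup_sum lookup_single when_def)
  ultimately show ?thesis by (simp add: diff_monomial_def)
qed

lemma functional_span_expand:
  fixes N :: nat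
  assumes "inj_on L {1..N}" "h \<in> functional.span (L ` {1..N})"
  obtains a where "h = (\<lambda>f. \<Sum>i=1..N. a i * L i f)"
proof -
  from assms(2) obtain u where "h = (\<Sum>v\<in>L ` {1..N}. functional_scale (u v) v)"
    using functional.span_finite[of "L ` {1..N}"] by blast
  also have "\<dots> = (\<Sum>i=1..N. functional_scale (u (L i)) (L i))"
    using assms(1) by (simp add: sum.reindex)
  also have "\<dots> = (\<lambda>f. \<Sum>i=1..N. u (L i) * L i f)"
  proof
    fix f
    have "(\<Sum>i\<in>A. functional_scale (u (L i)) (L i)) f = (\<Sum>i\<in>A. u (L i) * L i f)"
      if "finite A" for A
      using that by induction (auto simp: functional_scale_def)
    then show "(\<Sum>i=1..N. functional_scale (u (L i)) (L i)) f = (\<Sum>i=1..N. u (L i) * L i f)"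
      by simp
  qed
  finally show ?thesis by (rule that)
qed

lemma functional_independentD:
  fixes N :: nat
  assumes "inj_on L {1..N}" "functional.independent (L ` {1..N})"
    and "\<And>f. (\<Sum>i=1..N. a i * L i f) = 0" and "i \<in> {1..N}"
  shows "a i = 0"
proof -
  have eq: "(\<Sum>i\<in>A. functional_scale (a i) (L i)) f = (\<Sum>i\<in>A. a i * L i f)" if "finite A" for A f
    using that by induction (auto simp: functional_scale_def)
  let ?u = "\<lambda>v. a (the_inv_into {1..N} L v)"
  have "(\<Sum>v\<in>L ` {1..N}. functional_scale (?u v) v) = (\<Sum>i=1..N. functional_scale (a i) (L i))"
    using assms(1) by (simp add: sum.reindex the_inv_into_f_f)
  also have "\<dots> = 0"
    using eq[of "{1..N}"] assms(3) by (simp add: fun_eq_iff)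
  finally have "?u (L i) = 0"
    using assms(2,4) functional.independentD[of "L ` {1..N}" "L ` {1..N}" ?u "L i"] by auto
  then show ?thesis using assms(1,4) by (simp add: the_inv_into_f_f)
qed

lemma unisolvent_change_of_basis:
  assumes L: "functional_basis N L \<Delta>" and M: "functional_basis N M \<Delta>"
    and u: "unisolvent N L T"
  shows "unisolvent N M T"
proof -
  have "\<exists>a. M i = (\<lambda>f. \<Sum>j=1..N. a j * L j f)" if "i \<in> {1..N}" for i
  proof -
    have "M i \<in> functional.span (L ` {1..N})"
      using L M that functional.span_base[of "M i" "M ` {1..N}"]
      by (auto simp only: functional_basis_def)
    then show ?thesis
      using L functional_span_expand[of L N "M i"] unfolding functional_basis_def by blast
  qed
  then obtain a where a: "\<And>i f. i \<in> {1..N} \<Longrightarrow> M i f = (\<Sum>j=1..N. a i j * L j f)"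
    by metis
  have "\<exists>b. L i = (\<lambda>f. \<Sum>j=1..N. b j * M j f)" if "i \<in> {1..N}" for i
  proof -
    have "L i \<in> functional.span (M ` {1..N})"
      using L M that functional.span_base[of "L i" "L ` {1..N}"]
      by (auto simp only: functional_basis_def)
    then show ?thesis
      using M functional_span_expand[of M N "L i"] unfolding functional_basis_def by blast
  qed
  then obtain b where b: "\<And>i f. i \<in> {1..N} \<Longrightarrow> L i f = (\<Sum>j=1..N. b i j * M j f)"
    by metis
  have ab: "(\<Sum>j=1..N. a i j * b j k) = (if i = k then 1 else 0)"
    if i: "i \<in> {1..N}" and k: "k \<in> {1..N}" for i k
  proof -
    have "(\<Sum>k=1..N. ((\<Sum>j=1..N. a i j * b j k) - (if i = k then 1 else 0)) * M k f) = 0" for f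
    proof -
      have "M i f = (\<Sum>j=1..N. a i j * (\<Sum>k=1..N. b j k * M k f))"
        using a[OF i, of f] b by simp
      also have "\<dots> = (\<Sum>k=1..N. \<Sum>j=1..N. a i j * b j k * M k f)"
        unfolding sum_distrib_left by (subst sum.swap) (simp add: mult.assoc)
      finally show ?thesis
        using i by (simp add: left_diff_distrib sum_subtractf sum_distrib_right if_distrib[of "\<lambda>x. x * _"] cong: if_cong)
    qed
    moreover have "inj_on M {1..N}" "functional.independent (M ` {1..N})"
      using M unfolding functional_basis_def by blast+
    ultimately have "(\<Sum>j=1..N. a i j * b j k) - (if i = k then 1 else 0) = 0"
      using k by (intro functional_independentD[of M N "\<lambda>k. (\<Sum>j=1..N. a i j * b j k) - (if i = k then 1 else 0)"])
    then show ?thesis by simp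
  qed
  have iff: "(\<forall>i\<in>{1..N}. M i p = c i) \<longleftrightarrow> (\<forall>j\<in>{1..N}. L j p = (\<Sum>k=1..N. b j k * c k))" for p c
  proof
    assume "\<forall>i\<in>{1..N}. M i p = c i"
    then show "\<forall>j\<in>{1..N}. L j p = (\<Sum>k=1..N. b j k * c k)" by (simp add: b)
  next
    assume l: "\<forall>j\<in>{1..N}. L j p = (\<Sum>k=1..N. b j k * c k)"
    show "\<forall>i\<in>{1..N}. M i p = c i"
    proof
      fix i assume i: "i \<in> {1..N}"
      have "M i p = (\<Sum>j=1..N. a i j * (\<Sum>k=1..N. b j k * c k))"
        using a[OF i, of p] l by simp
      also have "\<dots> = (\<Sum>k=1..N. (\<Sum>j=1..N. a i j * b j k) * c k)"
        unfolding sum_distrib_left sum_distrib_right by (subst sum.swap) (simp add: mult.assoc)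
      also have "\<dots> = (\<Sum>k=1..N. (if i = k then 1 else 0) * c k)"
        using ab[OF i] by simp
      also have "\<dots> = c i"
        using i by (simp add: if_distrib[of "\<lambda>x. x * _"] cong: if_cong)
      finally show "M i p = c i" .
    qed
  qed
  show ?thesis unfolding unisolvent_def iff
  proof
    fix c
    show "\<exists>!p. p \<in> monomial_span T \<and> (\<forall>j\<in>{1..N}. L j p = (\<Sum>k=1..N. b j k * c k))"
      using u[unfolded unisolvent_def, rule_format, of "\<lambda>j. \<Sum>k=1..N. b j k * c k"] .
  qed
qed

lemma functional_basis_dim:
  assumes "functional_basis N L \<Delta>"
  shows "functional.dim \<Delta> = N"
  using assms functional.dim_span_eq_card_independent[of "L ` {1..N}"]
  unfolding functional_basis_def by (metis card_atLeastAtMost card_image diff_Suc_1)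

lemma proper_interpolation_basis_iff:
  assumes L: "functional_basis N L \<Delta>"
  shows "proper_interpolation_basis \<Delta> T \<longleftrightarrow> finite T \<and> card T = N \<and> unisolvent N L T"
proof
  assume "proper_interpolation_basis \<Delta> T"
  then obtain N' L' where *: "finite T" "functional_basis N' L' \<Delta>" "card T = N'" "unisolvent N' L' T"
    by (auto simp: proper_interpolation_basis_def)
  moreover have "N' = N" using functional_basis_dim[OF L] functional_basis_dim[OF *(2)] by simp
  ultimately show "finite T \<and> card T = N \<and> unisolvent N L T"
    using unisolvent_change_of_basis[OF _ L] by auto
next
  assume "finite T \<and> card T = N \<and> unisolvent N L T"
  then show "proper_interpolation_basis \<Delta> T"
    using L by (auto simp: proper_interpolation_basis_def)
qed

end

theory Submission
  imports Defs
begin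

text \<open>
  Write \<open>\<beta>\<^sub>i = lm(P\<^sub>i)\<close> and \<open>L\<^sub>i = \<delta>\<^sub>z \<circ> P\<^sub>i(D)\<close>. Since \<open>D\<^sup>\<alpha> x\<^sup>\<beta> = 0\<close> unless \<open>x\<^sup>\<alpha>\<close> divides \<open>x\<^sup>\<beta>\<close>, the
  functional \<open>L\<^sub>i\<close> kills every monomial below \<open>\<beta>\<^sub>i\<close> and takes the value \<open>\<beta>\<^sub>i! \<noteq> 0\<close> at \<open>\<beta>\<^sub>i\<close>. Hence the
  matrix \<open>L\<^sub>i(\<beta>\<^sub>j)\<close> is triangular and invertible, which gives unisolvence. If \<open>\<beta>\<^sub>k\<close> is replaced by a
  lower monomial, a triangular solve among the \<open>L\<^sub>i\<close> with \<open>\<beta>\<^sub>i\<close> not below \<open>\<beta>\<^sub>k\<close> gives a nontrivial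
  combination of functionals that vanishes at every \<open>\<beta>\<^sub>j\<close> with \<open>j \<noteq> k\<close> and at all monomials below
  \<open>\<beta>\<^sub>k\<close>, so the new set is not unisolvent.
\<close>

subsection \<open>Triangular systems\<close>

text \<open>Back substitution: an \<open>R\<close>-maximal \<open>m\<close> has
  \<open>A m j = 0\<close> for every other \<open>j\<close>, so the unknown \<open>x m\<close>
  occurs only in the equation at \<open>m\<close>. The other equations are solved by induction, and
  dividing by \<open>A m m\<close> settles the last one.\<close>

lemma triangular_system_solvable:
  fixes A :: "'i \<Rightarrow> 'i \<Rightarrow> 'a::field"
  assumes "finite I" "transp R" "irreflp R"
    and "\<And>i. i \<in> I \<Longrightarrow> A i i \<noteq> 0"
    and "\<And>i j. i \<in> I \<Longrightarrow> j \<in> I \<Longrightarrow> A i j \<noteq> 0 \<Longrightarrow> i = j \<or> R i j"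
  shows "\<exists>x. \<forall>j\<in>I. (\<Sum>i\<in>I. x i * A i j) = b j"
  using assms(1,4,5)
proof (induction I rule: finite_psubset_induct)
  case (psubset I)
  show ?case
  proof (cases "I = {}")
    case False
    have "asymp_on I R" by (rule asymp_onI) (metis assms(2,3) irreflpD transpD)
    moreover have "transp_on I R" using assms(2) by (rule transp_on_subset) simp
    ultimately obtain m where m: "m \<in> I" and max: "\<forall>j\<in>I. j \<noteq> m \<longrightarrow> \<not> R m j"
      using Finite_Set.bex_max_element[OF psubset.hyps(1) _ _ False] by blast
    have "\<exists>x. \<forall>j\<in>I - {m}. (\<Sum>i\<in>I - {m}. x i * A i j) = b j"
      using m psubset.prems by (intro psubset.IH) blast+
    then obtain x where x: "\<And>j. j \<in> I - {m} \<Longrightarrow> (\<Sum>i\<in>I - {m}. x i * A i j) = b j"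
      by blast
    define y where "y = x(m := (b m - (\<Sum>i\<in>I - {m}. x i * A i m)) / A m m)"
    have split: "(\<Sum>i\<in>I. y i * A i j) = y m * A m j + (\<Sum>i\<in>I - {m}. x i * A i j)" for j
      using psubset.hyps(1) m by (simp add: sum.remove y_def)
    have "(\<Sum>i\<in>I. y i * A i j) = b j" if "j \<in> I" for j
    proof (cases "j = m")
      case True
      then show ?thesis using psubset.prems(1)[OF m] unfolding split by (simp add: y_def)
    next
      case False
      then have "A m j = 0" using psubset.prems(2)[OF m that] max that by blast
      then show ?thesis unfolding split using x that False by simp
    qed
    then show ?thesis by blast
  qed simp
qed

subsection \<open>Interpolation functionals\<close>

lemma mpoly_eval_superset:
  assumes "finite S" "keys f \<subseteq> S"
  shows "mpoly_eval z f = (\<Sum>m\<in>S. lookup f m * (\<Prod>i\<in>UNIV. (z $ i) ^ lookup m i))"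
  unfolding mpoly_eval_def using assms
  by (intro sum.mono_neutral_left) (auto simp: in_keys_iff)

lemma mpoly_eval_zero [simp]: "mpoly_eval z 0 = 0"
  by (simp add: mpoly_eval_def)

lemma mpoly_eval_add: "mpoly_eval z (f + g) = mpoly_eval z f + mpoly_eval z g"
  using keys_add[of f g]
  by (simp add: mpoly_eval_superset[of "keys f \<union> keys g"] lookup_add distrib_right sum.distrib)

lemma mpoly_eval_scale: "mpoly_eval z (mpoly_scale c f) = c * mpoly_eval z f"
proof -
  have "keys (mpoly_scale c f) \<subseteq> keys f" by (auto simp: in_keys_iff)
  then show ?thesis
    by (simp add: mpoly_eval_superset[of "keys f"] sum_distrib_left mult.assoc)
qed

lemma diff_monomial_add: "diff_monomial \<alpha> (f + g) = diff_monomial \<alpha> f + diff_monomial \<alpha> g"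
  by (rule poly_mapping_eqI) (simp add: lookup_diff_monomial lookup_add distrib_left)

lemma diff_monomial_scale: "diff_monomial \<alpha> (mpoly_scale c f) = mpoly_scale c (diff_monomial \<alpha> f)"
  by (rule poly_mapping_eqI) (simp add: lookup_diff_monomial)

lemma birkhoff_functional_eq_sum:
  "birkhoff_functional z P f = (\<Sum>\<alpha>\<in>keys P. lookup P \<alpha> * mpoly_eval z (diff_monomial \<alpha> f))"
proof -
  have "mpoly_eval z (\<Sum>\<alpha>\<in>S. mpoly_scale (lookup P \<alpha>) (diff_monomial \<alpha> f)) =
      (\<Sum>\<alpha>\<in>S. lookup P \<alpha> * mpoly_eval z (diff_monomial \<alpha> f))" if "finite S" for S
    using that by induction (simp_all add: mpoly_eval_add mpoly_eval_scale)
  then show ?thesis by (simp add: birkhoff_functional_def diff_op_def)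
qed

lemma linear_birkhoff_functional:
  "Vector_Spaces.linear mpoly_scale (*) (birkhoff_functional z P)"
proof unfold_locales
  fix f g c
  show "birkhoff_functional z P (f + g) = birkhoff_functional z P f + birkhoff_functional z P g"
    by (simp add: birkhoff_functional_eq_sum diff_monomial_add mpoly_eval_add distrib_left
        sum.distrib)
  show "birkhoff_functional z P (mpoly_scale c f) = c * birkhoff_functional z P f"
    by (simp add: birkhoff_functional_eq_sum diff_monomial_scale mpoly_eval_scale sum_distrib_left
        mult.left_commute)
qed (simp_all add: algebra_simps)

section \<open>Derivatives of monomials\<close>

lemma diff_monomial_single_self:
  "diff_monomial \<alpha> (Poly_Mapping.single \<alpha> (1::'a::field_char_0)) =
    Poly_Mapping.single 0 (\<Prod>i\<in>UNIV. fact (lookup \<alpha> i))"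
  by (rule poly_mapping_eqI)
     (auto simp: lookup_diff_monomial lookup_single when_def pochhammer_fact)

text \<open>The assumption is non-divisibility written additively, to match the shifted index
  \<open>k + \<alpha>\<close> in \<open>lookup_diff_monomial\<close>.\<close>

lemma diff_monomial_single_eq_0:
  assumes "\<And>k. \<beta> \<noteq> k + \<alpha>"
  shows "diff_monomial \<alpha> (Poly_Mapping.single \<beta> (1::'a::field)) = 0"
  by (rule poly_mapping_eqI) (use assms in \<open>auto simp: lookup_diff_monomial lookup_single when_def\<close>)

section \<open>Graded orders and least monomials\<close>

lemma graded_order_add:
  assumes "graded_order prec" "k \<noteq> 0"
  shows "prec \<alpha> (k + \<alpha>)"
proof -
  obtain i where "lookup k i \<noteq> 0" using assms(2) by (metis poly_mapping_eqI lookup_zero)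
  then have "0 < total_degree k"
    unfolding total_degree_def by (intro sum_pos2[of _ i]) auto
  then have "total_degree \<alpha> < total_degree (k + \<alpha>)"
    by (simp add: total_degree_def lookup_add sum.distrib)
  then show ?thesis using assms(1) by (simp add: graded_order_def)
qed

text \<open>Justifies the definite description in \<open>lm\<close>: a finite nonempty support has a
  minimal element, and totality makes it the unique least one.\<close>

lemma lm_least:
  assumes "monomial_order prec" "P \<noteq> 0"
  shows "lm prec P \<in> keys P \<and> (\<forall>m\<in>keys P. m \<noteq> lm prec P \<longrightarrow> prec (lm prec P) m)"
proof -
  have ord: "irreflp prec" "transp prec" "totalp prec"
    using assms(1) by (auto simp: monomial_order_def)
  have "asymp_on (keys P) prec" by (rule asymp_onI) (metis ord(1,2) irreflpD transpD)
  moreover have "transp_on (keys P) prec" using ord(2) by (rule transp_on_subset) simp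
  ultimately obtain l where l: "l \<in> keys P" "\<forall>m\<in>keys P. m \<noteq> l \<longrightarrow> \<not> prec m l"
    using Finite_Set.bex_min_element[of "keys P" prec] assms(2) by auto
  then have least: "\<forall>m\<in>keys P. m \<noteq> l \<longrightarrow> prec l m" using ord(3) by (metis totalpD)
  have "lm prec P = l"
    unfolding lm_def
  proof (rule the_equality)
    fix m assume "m \<in> keys P \<and> (\<forall>m'\<in>keys P. m' \<noteq> m \<longrightarrow> prec m m')"
    then show "m = l" using l by metis
  qed (use l(1) least in simp)
  with l(1) least show ?thesis by simp
qed

text \<open>Every \<alpha> in the support of \<open>P\<close> lies strictly above \<beta>, whereas a
  divisor of \<beta> is equal to it or below it.\<close>

lemma birkhoff_functional_below_lm:
  fixes z :: "'a::field ^ 'n::finite"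
  assumes "graded_order prec" "P \<noteq> 0" "prec \<beta> (lm prec P)"
  shows "birkhoff_functional z P (Poly_Mapping.single \<beta> 1) = 0"
proof -
  have ord: "monomial_order prec" "irreflp prec" "transp prec"
    using assms(1) by (auto simp: graded_order_def monomial_order_def)
  have "diff_monomial \<alpha> (Poly_Mapping.single \<beta> (1::'a)) = 0" if "\<alpha> \<in> keys P" for \<alpha>
  proof (rule diff_monomial_single_eq_0)
    fix k
    have "prec \<beta> \<alpha>" using lm_least[OF ord(1) assms(2)] that assms(3) ord(3) by (metis transpD)
    then show "\<beta> \<noteq> k + \<alpha>"
      using graded_order_add[OF assms(1), of k \<alpha>] ord(2,3) by (metis add_0 irreflpD transpD)
  qed
  then show ?thesis by (simp add: birkhoff_functional_eq_sum)
qed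

text \<open>All other support monomials lie above \<open>lm prec P\<close> and cannot divide it. The
  one surviving term is a nonzero coefficient times factorials, which are nonzero in characteristic
  0.\<close>

lemma birkhoff_functional_at_lm:
  fixes z :: "'a::real_normed_field ^ 'n::finite"
  assumes "graded_order prec" "P \<noteq> 0"
  shows "birkhoff_functional z P (Poly_Mapping.single (lm prec P) 1) \<noteq> 0"
proof -
  let ?l = "lm prec P"
  have ord: "monomial_order prec" "irreflp prec" "transp prec"
    using assms(1) by (auto simp: graded_order_def monomial_order_def)
  note l = lm_least[OF ord(1) assms(2)]
  have "diff_monomial \<alpha> (Poly_Mapping.single ?l (1::'a)) = 0" if "\<alpha> \<in> keys P - {?l}" for \<alpha>
  proof (rule diff_monomial_single_eq_0)
    fix k
    have "prec ?l \<alpha>" using l that by blast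
    then show "?l \<noteq> k + \<alpha>"
      using graded_order_add[OF assms(1), of k \<alpha>] ord(2,3) by (metis add_0 irreflpD transpD)
  qed
  then have "birkhoff_functional z P (Poly_Mapping.single ?l 1) =
      lookup P ?l * (\<Prod>i\<in>UNIV. fact (lookup ?l i))"
    using l by (simp add: birkhoff_functional_eq_sum sum.remove[of _ ?l] diff_monomial_single_self
        mpoly_eval_def)
  also have "\<dots> \<noteq> 0" using l by (simp add: in_keys_iff)
  finally show ?thesis .
qed

subsection \<open>Unisolvence\<close>

text \<open>Span induction confines the support of \<open>p\<close> to \<open>T\<close>, so the
  coordinates of \<open>p\<close> are its own coefficients.\<close>

lemma monomial_span_expand:
  assumes "finite T" "p \<in> monomial_span T"
  shows "p = (\<Sum>m\<in>T. mpoly_scale (lookup p m) (Poly_Mapping.single m 1))"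
proof -
  have p: "lookup p m = 0" if "m \<notin> T" for m
    using assms(2) unfolding monomial_span_def
  proof (induction rule: mpoly.span_induct_alt)
    case (step c x y)
    then obtain t where "t \<in> T" "x = Poly_Mapping.single t 1" by blast
    with step.IH that show ?case
      by (auto simp: lookup_add lookup_single when_def)
  qed simp
  show ?thesis
  proof (rule poly_mapping_eqI)
    fix k
    have "lookup (\<Sum>m\<in>T. mpoly_scale (lookup p m) (Poly_Mapping.single m 1)) k =
        (\<Sum>m\<in>T. if m = k then lookup p m else 0)"
      by (auto simp: lookup_sum lookup_single when_def intro!: sum.cong)
    then show "lookup p k = lookup (\<Sum>m\<in>T. mpoly_scale (lookup p m) (Poly_Mapping.single m 1)) k"
      using assms(1) p by simp
  qed
qed

lemma linear_functional_on_monomial_span: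
  assumes "Vector_Spaces.linear mpoly_scale (*) L" "finite T" "p \<in> monomial_span T"
  shows "L p = (\<Sum>m\<in>T. lookup p m * L (Poly_Mapping.single m 1))"
proof -
  interpret L: Vector_Spaces.linear mpoly_scale "(*)" L by fact
  have "L p = L (\<Sum>m\<in>T. mpoly_scale (lookup p m) (Poly_Mapping.single m 1))"
    using monomial_span_expand[OF assms(2,3)] by simp
  then show ?thesis by (simp add: L.sum L.scale)
qed

text \<open>Evaluating a vanishing combination at the \<open>k\<close>-th dual polynomial isolates
  the \<open>k\<close>-th coefficient; the same polynomials tell the \<open>L i\<close>
  apart.\<close>

lemma functional_basisI:
  fixes L :: "nat \<Rightarrow> ('n, 'a::field) mpoly \<Rightarrow> 'a"
  assumes "\<And>i. i \<in> {1..N} \<Longrightarrow> Vector_Spaces.linear mpoly_scale (*) (L i)"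
    and dual: "\<And>k. k \<in> {1..N} \<Longrightarrow> \<exists>p. \<forall>i\<in>{1..N}. L i p = (if i = k then 1 else 0)"
  shows "functional_basis N L (functional.span (L ` {1..N}))"
proof -
  obtain p where p: "\<And>i k. i \<in> {1..N} \<Longrightarrow> k \<in> {1..N} \<Longrightarrow> L i (p k) = (if i = k then 1 else 0)"
    using dual by metis
  have inj: "inj_on L {1..N}"
    by (rule inj_onI) (metis p zero_neq_one)
  have "functional.independent (L ` {1..N})"
  proof
    assume "functional.dependent (L ` {1..N})"
    then obtain u v where v: "v \<in> L ` {1..N}" "u v \<noteq> 0"
      and u: "(\<Sum>v\<in>L ` {1..N}. functional_scale (u v) v) = 0"
      by (auto simp: functional.dependent_finite)
    from v(1) obtain k where k: "k \<in> {1..N}" "v = L k" by blast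
    have eq: "(\<Sum>i\<in>A. functional_scale (u (L i)) (L i)) f = (\<Sum>i\<in>A. u (L i) * L i f)"
      if "finite A" for A f
      using that by induction (auto simp: functional_scale_def)
    have "(\<Sum>i=1..N. functional_scale (u (L i)) (L i)) = 0"
      using u inj by (simp add: sum.reindex)
    then have "(\<Sum>i=1..N. u (L i) * L i (p k)) = 0"
      using eq[of "{1..N}" "p k"] by simp
    also have "(\<Sum>i=1..N. u (L i) * L i (p k)) = (\<Sum>i=1..N. if i = k then u (L i) else 0)"
      using p k(1) by (intro sum.cong) auto
    finally show False using v(2) k by simp
  qed
  with inj assms(1) show ?thesis by (simp add: functional_basis_def)
qed

section \<open>Abstract functionals triangular on a family of monomials\<close>

context
  fixes prec :: "'n monomial \<Rightarrow> 'n monomial \<Rightarrow> bool"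
    and L :: "nat \<Rightarrow> ('n, 'a::field) mpoly \<Rightarrow> 'a"
    and \<beta> :: "nat \<Rightarrow> 'n monomial"
    and N :: nat
  assumes ord: "irreflp prec" "transp prec" "totalp prec"
    and linear: "\<And>i. i \<in> {1..N} \<Longrightarrow> Vector_Spaces.linear mpoly_scale (*) (L i)"
    and inj: "inj_on \<beta> {1..N}"
    and diag: "\<And>i. i \<in> {1..N} \<Longrightarrow> L i (Poly_Mapping.single (\<beta> i) 1) \<noteq> 0"
    and below: "\<And>i m. i \<in> {1..N} \<Longrightarrow> prec m (\<beta> i) \<Longrightarrow> L i (Poly_Mapping.single m 1) = 0"
begin

text \<open>By totality and injectivity of \<beta>, the only other possibility is
  \<open>prec (\<beta> j) (\<beta> i)\<close>, where \<open>below\<close> makes the entry 0.\<close>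

lemma triangular_offdiag:
  assumes "i \<in> {1..N}" "j \<in> {1..N}" "L i (Poly_Mapping.single (\<beta> j) 1) \<noteq> 0"
  shows "i = j \<or> prec (\<beta> i) (\<beta> j)"
  using assms below ord(3) inj by (metis inj_onD totalpD)

lemma triangular_interpolant:
  "\<exists>p\<in>monomial_span (\<beta> ` {1..N}). \<forall>i\<in>{1..N}. L i p = c i"
proof -
  have "\<exists>y. \<forall>i\<in>{1..N}. (\<Sum>j=1..N. y j * L i (Poly_Mapping.single (\<beta> j) 1)) = c i"
  \<comment> \<open>The unknowns are indexed by monomials and the equations by functionals, so the
    matrix is transposed and the relation reversed.\<close>
  proof (rule triangular_system_solvable[where R = "\<lambda>i j. prec (\<beta> j) (\<beta> i)"])
    show "transp (\<lambda>i j. prec (\<beta> j) (\<beta> i))" using ord(2) by (auto intro!: transpI elim: transpE)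
    show "irreflp (\<lambda>i j. prec (\<beta> j) (\<beta> i))" using ord(1) by (auto simp: irreflp_def)
  qed (use diag triangular_offdiag in auto)
  then obtain y where
    y: "\<forall>i\<in>{1..N}. (\<Sum>j=1..N. y j * L i (Poly_Mapping.single (\<beta> j) 1)) = c i" by blast
  let ?p = "\<Sum>j=1..N. mpoly_scale (y j) (Poly_Mapping.single (\<beta> j) 1)"
  have "?p \<in> monomial_span (\<beta> ` {1..N})"
    unfolding monomial_span_def
    by (intro mpoly.span_sum mpoly.span_scale mpoly.span_base imageI)
  moreover have "L i ?p = c i" if "i \<in> {1..N}" for i
  proof -
    interpret Li: Vector_Spaces.linear mpoly_scale "(*)" "L i" by (rule linear[OF that])
    show ?thesis using y that by (simp add: Li.sum Li.scale)
  qed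
  ultimately show ?thesis by blast
qed

lemma triangular_functional_basis: "functional_basis N L (functional.span (L ` {1..N}))"
proof (rule functional_basisI[OF linear])
  show "\<exists>p. \<forall>i\<in>{1..N}. L i p = (if i = k then 1 else 0)" for k
    using triangular_interpolant[of "\<lambda>i. if i = k then 1 else 0"] by blast
qed

text \<open>A second triangular solve combines the \<open>L i\<close> into a functional that reads
  off the coefficient of \<open>\<beta> k\<close> on this span, so that coefficient vanishes with
  all the \<open>L i p\<close>.\<close>

lemma triangular_kernel:
  assumes p: "p \<in> monomial_span (\<beta> ` {1..N})" and zero: "\<And>i. i \<in> {1..N} \<Longrightarrow> L i p = 0"
  shows "p = 0"
proof -
  have *: "(\<Sum>j=1..N. lookup p (\<beta> j) * L i (Poly_Mapping.single (\<beta> j) 1)) = 0"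
    if "i \<in> {1..N}" for i
    using linear_functional_on_monomial_span[OF linear[OF that] _ p] zero[OF that] inj
    by (simp add: sum.reindex)
  have "lookup p (\<beta> k) = 0" if k: "k \<in> {1..N}" for k
  proof -
    have "\<exists>x. \<forall>j\<in>{1..N}. (\<Sum>i=1..N. x i * L i (Poly_Mapping.single (\<beta> j) 1)) =
        (if j = k then 1 else 0)"
    proof (rule triangular_system_solvable[where R = "\<lambda>i j. prec (\<beta> i) (\<beta> j)"])
      show "transp (\<lambda>i j. prec (\<beta> i) (\<beta> j))" using ord(2) by (auto intro!: transpI elim: transpE)
      show "irreflp (\<lambda>i j. prec (\<beta> i) (\<beta> j))" using ord(1) by (auto simp: irreflp_def)
    qed (use diag triangular_offdiag in auto)
    then obtain x where x: "\<forall>j\<in>{1..N}. (\<Sum>i=1..N. x i * L i (Poly_Mapping.single (\<beta> j) 1)) =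
        (if j = k then 1 else 0)" by blast
    have "lookup p (\<beta> k) = (\<Sum>j=1..N. lookup p (\<beta> j) * (if j = k then 1 else 0))"
      using k by (simp add: if_distrib[of "\<lambda>x. _ * x"] cong: if_cong)
    also have "\<dots> = (\<Sum>j=1..N. lookup p (\<beta> j) * (\<Sum>i=1..N. x i * L i (Poly_Mapping.single (\<beta> j) 1)))"
      using x by simp
    also have "\<dots> = (\<Sum>i=1..N. x i * (\<Sum>j=1..N. lookup p (\<beta> j) * L i (Poly_Mapping.single (\<beta> j) 1)))"
      unfolding sum_distrib_left by (subst sum.swap) (simp add: mult.left_commute)
    also have "\<dots> = 0" using * by simp
    finally show ?thesis .
  qed
  then have "(\<Sum>m\<in>\<beta> ` {1..N}. mpoly_scale (lookup p m) (Poly_Mapping.single m 1)) = 0"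
    by (intro sum.neutral) auto
  then show ?thesis
    using monomial_span_expand[OF _ p] by simp
qed

lemma triangular_unisolvent: "unisolvent N L (\<beta> ` {1..N})"
  unfolding unisolvent_def
proof
  fix c
  obtain p where p: "p \<in> monomial_span (\<beta> ` {1..N})" "\<forall>i\<in>{1..N}. L i p = c i"
    using triangular_interpolant by blast
  have "q = p" if q: "q \<in> monomial_span (\<beta> ` {1..N})" "\<forall>i\<in>{1..N}. L i q = c i" for q
  proof -
    have "L i (q - p) = 0" if "i \<in> {1..N}" for i
    proof -
      interpret Li: Vector_Spaces.linear mpoly_scale "(*)" "L i" by (rule linear[OF that])
      show ?thesis using p(2) q(2) that by (simp add: Li.diff)
    qed
    moreover have "q - p \<in> monomial_span (\<beta> ` {1..N})"
      using p(1) q(1) unfolding monomial_span_def by (rule_tac mpoly.span_diff)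
    ultimately have "q - p = 0" by (rule_tac triangular_kernel)
    then show ?thesis by simp
  qed
  with p show "\<exists>!p. p \<in> monomial_span (\<beta> ` {1..N}) \<and> (\<forall>i\<in>{1..N}. L i p = c i)" by blast
qed

lemma triangular_replace_lower:
  assumes k: "k \<in> {1..N}" and m: "prec m (\<beta> k)"
  shows "\<not> unisolvent N L (insert m (\<beta> ` {1..N} - {\<beta> k}))" (is "\<not> unisolvent N L ?T")
proof
  assume u: "unisolvent N L ?T"
  \<comment> \<open>For \<open>i\<close> in \<open>I\<close>, every monomial below
    \<open>\<beta> k\<close> is also below \<open>\<beta> i\<close>, hence killed by
    \<open>L i\<close>; irreflexivity puts \<open>k\<close> itself in \<open>I\<close>.\<close>
  define I where "I = {i \<in> {1..N}. \<not> prec (\<beta> i) (\<beta> k)}"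
  have I: "finite I" "k \<in> I" "I \<subseteq> {1..N}" using k ord(1) by (auto simp: I_def irreflp_def)
  have "\<exists>x. \<forall>j\<in>I. (\<Sum>i\<in>I. x i * L i (Poly_Mapping.single (\<beta> j) 1)) = (if j = k then 1 else 0)"
  proof (rule triangular_system_solvable[where R = "\<lambda>i j. prec (\<beta> i) (\<beta> j)"])
    show "transp (\<lambda>i j. prec (\<beta> i) (\<beta> j))" using ord(2) by (auto intro!: transpI elim: transpE)
    show "irreflp (\<lambda>i j. prec (\<beta> i) (\<beta> j))" using ord(1) by (auto simp: irreflp_def)
  qed (use I(1,3) diag triangular_offdiag in blast)+
  then obtain x where x: "\<And>j. j \<in> I \<Longrightarrow>
      (\<Sum>i\<in>I. x i * L i (Poly_Mapping.single (\<beta> j) 1)) = (if j = k then 1 else 0)" by blast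
  have low: "(\<Sum>i\<in>I. x i * L i (Poly_Mapping.single t 1)) = 0" if "prec t (\<beta> k)" for t
  proof (rule sum.neutral, rule ballI)
    fix i assume i: "i \<in> I"
    then have "prec t (\<beta> i)" using that ord(2,3) unfolding I_def
      by (metis (lifting) mem_Collect_eq totalpD transpD)
    then show "x i * L i (Poly_Mapping.single t 1) = 0" using below i I(3) by auto
  qed
  \<comment> \<open>Monomials below \<open>\<beta> k\<close>, including \<open>m\<close>, vanish by
    \<open>low\<close>. Any other element of \<open>?T\<close> is some \<open>\<beta> j\<close> with
    \<open>j\<close> in \<open>I\<close> and \<open>j \<noteq> k\<close>, where the choice of
    \<open>x\<close> gives 0.\<close>
  have T: "(\<Sum>i\<in>I. x i * L i (Poly_Mapping.single t 1)) = 0" if "t \<in> ?T" for t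
  proof (cases "prec t (\<beta> k)")
    case False
    with that m obtain j where "j \<in> {1..N}" "t = \<beta> j" "j \<noteq> k" by blast
    with False x[of j] show ?thesis by (simp add: I_def)
  qed (rule low)
  have "x l = 0" if l: "l \<in> I" for l
  proof -
    \<comment> \<open>Applied to this dual interpolant the combination equals \<open>x l\<close>,
      but expanded over \<open>?T\<close> it is 0. Thus all of \<open>x\<close> vanishes, although
      the combination takes the value 1 at \<open>\<beta> k\<close>.\<close>
    obtain p where p: "p \<in> monomial_span ?T" "\<forall>i\<in>{1..N}. L i p = (if i = l then 1 else 0)"
      using u[unfolded unisolvent_def, rule_format, of "\<lambda>i. if i = l then 1 else 0"] by blast
    have "x l = (\<Sum>i\<in>I. x i * (if i = l then 1 else 0))"
      using l I(1) by (simp add: if_distrib[of "\<lambda>x. _ * x"] cong: if_cong)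
    also have "\<dots> = (\<Sum>i\<in>I. x i * L i p)" using p(2) I(3) by (intro sum.cong) auto
    also have "\<dots> = (\<Sum>i\<in>I. x i * (\<Sum>t\<in>?T. lookup p t * L i (Poly_Mapping.single t 1)))"
    proof (intro sum.cong refl)
      fix i assume "i \<in> I"
      then have "Vector_Spaces.linear mpoly_scale (*) (L i)" using linear I(3) by blast
      then show "x i * L i p = x i * (\<Sum>t\<in>?T. lookup p t * L i (Poly_Mapping.single t 1))"
        using linear_functional_on_monomial_span[OF _ _ p(1), of "L i"] by simp
    qed
    also have "\<dots> = (\<Sum>t\<in>?T. lookup p t * (\<Sum>i\<in>I. x i * L i (Poly_Mapping.single t 1)))"
      unfolding sum_distrib_left by (subst sum.swap) (simp only: mult.left_commute)
    also have "\<dots> = 0" by (rule sum.neutral) (use T in simp)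
    finally show ?thesis .
  qed
  then show False using x[OF I(2)] by simp
qed

lemma triangular_minimal_monomial_basis:
  "minimal_monomial_basis prec (functional.span (L ` {1..N})) (\<beta> ` {1..N})"
  \<comment> \<open>Replaces the existentially chosen basis of the span by the given
    \<open>L\<close>, both for the original set and for each modified one.\<close>
  unfolding minimal_monomial_basis_def proper_interpolation_basis_iff[OF triangular_functional_basis]
  using triangular_unisolvent triangular_replace_lower inj by (auto simp: card_image)

end

section \<open>Birkhoff functionals of a reverse reduced set\<close>

theorem theorem3p1:
  fixes z :: "'a::real_normed_field ^ 'n::finite"
    and prec :: "'n monomial \<Rightarrow> 'n monomial \<Rightarrow> bool"
    and P :: "nat \<Rightarrow> ('n, 'a) mpoly"
    and N :: nat
    and \<Delta> :: "(('n, 'a) mpoly \<Rightarrow> 'a) set"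
  assumes "graded_order prec"
    and "\<Delta> = functional.span ((\<lambda>i. birkhoff_functional z (P i)) ` {1..N})"
    and "reverse_reduced prec N P"
  shows "minimal_monomial_basis prec \<Delta> ((\<lambda>i. lm prec (P i)) ` {1..N})"
  unfolding assms(2)
proof (rule triangular_minimal_monomial_basis)
  have lm1: "\<And>i. i \<in> {1..N} \<Longrightarrow> lookup (P i) (lm prec (P i)) = 1"
    and red: "\<And>i j. i \<in> {1..N} \<Longrightarrow> j \<in> {1..N} \<Longrightarrow> i \<noteq> j \<Longrightarrow> lm prec (P i) \<notin> keys (P j)"
    using assms(3) by (auto simp: reverse_reduced_def)
  have nz: "P i \<noteq> 0" if "i \<in> {1..N}" for i
    using lm1[OF that] by auto
  show "irreflp prec" "transp prec" "totalp prec"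
    using assms(1) by (auto simp: graded_order_def monomial_order_def)
  show "inj_on (\<lambda>i. lm prec (P i)) {1..N}"
    \<comment> \<open>A least monomial shared by \<open>P i\<close> and \<open>P j\<close> would
      have coefficient 1 in \<open>P j\<close>, against \<open>red\<close>.\<close>
    by (rule inj_onI) (metis red lm1 in_keys_iff zero_neq_one)
  show "Vector_Spaces.linear mpoly_scale (*) (birkhoff_functional z (P i))" for i
    by (rule linear_birkhoff_functional)
  show "birkhoff_functional z (P i) (Poly_Mapping.single (lm prec (P i)) 1) \<noteq> 0"
    if "i \<in> {1..N}" for i
    by (rule birkhoff_functional_at_lm[OF assms(1) nz[OF that]])
  show "birkhoff_functional z (P i) (Poly_Mapping.single m 1) = 0"
    if "i \<in> {1..N}" "prec m (lm prec (P i))" for i m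
    by (rule birkhoff_functional_below_lm[OF assms(1) nz[OF that(1)] that(2)])
qed

end
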